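(* Let $n \ge 3$ be an integer, let $K$ be a field of prime characteristic $p$ with $p \nmid n$, and let $R = K[X_1, \dots, X_n]/(X_1^n + \dots + X_n^n)$. Let $x_i$ denote the image of $X_i$ in $R$. Then $$(x_1 \dotsm x_n)^{n-2} \in (x_1^{n-1}, \dots, x_n^{n-1})^*,$$ where $^*$ denotes tight closure of ideals of $R$.
   Context: Let $R$ be a Noetherian ring of prime characteristic $p>0$. Let $q = p^e$ denote a power of $p$, where $e$ is a variable nonnegative integer. For an ideal $I = (a_1, \dots, a_t) \subseteq R$, put $I^{[q]} = (a_1^q, \dots, a_t^q)$. Let $R^{\circ}$ denote the complement in $R$ of the union of the minimal primes of $R$. An element $x \in R$ is in the tight closure $I^*$ of $I$ if there exists $c \in R^{\circ}$ such that $c x^q \in I^{[q]}$ for all $q = p^e \gg 0$. *)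

theory Defs
  imports
    "HOL-Algebra.Algebra"
    "HOL-Algebra.Algebraic_Closure_Type"
    "HOL-Library.Poly_Mapping"
begin

section \<open>Tight closure\<close>

definition minimal_prime :: "('a, 'm) ring_scheme \<Rightarrow> 'a set \<Rightarrow> bool"
  where "minimal_prime R P \<longleftrightarrow>
    primeideal P R \<and> (\<forall>Q. primeideal Q R \<and> Q \<subseteq> P \<longrightarrow> Q = P)"

definition ring_circ :: "('a, 'm) ring_scheme \<Rightarrow> 'a set"
  where "ring_circ R = carrier R - \<Union>{P. minimal_prime R P}"

text \<open>
  For an ideal \<open>I\<close> with finite generating set \<open>A\<close>, this is the ideal generated by the
  \<open>q\<close>-th powers of the elements of \<open>A\<close>. It does not depend on \<open>A\<close> when \<open>R\<close> is a commutative
  ring of prime characteristic \<open>p\<close> and \<open>q\<close> is a power of \<open>p\<close>; see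
  \<open>frobenius_power_genideal\<close> below. It is only meaningful for finitely generated \<open>I\<close>.
\<close>

definition frobenius_power :: "('a, 'm) ring_scheme \<Rightarrow> 'a set \<Rightarrow> nat \<Rightarrow> 'a set"
  where "frobenius_power R I q =
    (THE J. \<exists>A. finite A \<and> A \<subseteq> carrier R \<and> I = Idl\<^bsub>R\<^esub> A \<and>
                J = Idl\<^bsub>R\<^esub> ((\<lambda>a. a [^]\<^bsub>R\<^esub> q) ` A))"

text \<open>
  The parameter \<open>p\<close> is the characteristic of \<open>R\<close>, and \<open>R\<close> is Noetherian.
\<close>

definition tight_closure :: "nat \<Rightarrow> ('a, 'm) ring_scheme \<Rightarrow> 'a set \<Rightarrow> 'a set"
  where "tight_closure p R I =
    {x \<in> carrier R. \<exists>c \<in> ring_circ R.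
       \<forall>\<^sub>F e in sequentially. c \<otimes>\<^bsub>R\<^esub> x [^]\<^bsub>R\<^esub> (p ^ e) \<in> frobenius_power R I (p ^ e)}"

context cring
begin

lemma binomial_cring:
  assumes a: "a \<in> carrier R" and b: "b \<in> carrier R"
  shows "(a \<oplus> b) [^] m = (\<Oplus>k\<in>{..m}. add_pow R (m choose k) (a [^] k \<otimes> b [^] (m - k)))"
proof (induction m)
  case 0
  then show ?case using a b by simp
next
  case (Suc m)
  let ?f = "\<lambda>k. add_pow R (m choose k) (a [^] k \<otimes> b [^] (m - k))"
  let ?g = "\<lambda>k. add_pow R (m choose k) (a [^] Suc k \<otimes> b [^] (m - k))"
  let ?h = "\<lambda>k. add_pow R (m choose k) (a [^] k \<otimes> b [^] (Suc m - k))"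
  let ?t = "\<lambda>k. add_pow R (Suc m choose k) (a [^] k \<otimes> b [^] (Suc m - k))"
  have "(\<Oplus>k\<in>{..m}. ?f k) \<otimes> a = (\<Oplus>k\<in>{..m}. ?f k \<otimes> a)"
    using a b by (intro finsum_ldistr) auto
  also have "\<dots> = (\<Oplus>k\<in>{..m}. ?g k)"
    using a b by (intro finsum_cong') (auto simp: add_pow_ldistr add_pow_rdistr m_ac)
  finally have A: "(\<Oplus>k\<in>{..m}. ?f k) \<otimes> a = (\<Oplus>k\<in>{..m}. ?g k)" .
  have "(\<Oplus>k\<in>{..m}. ?f k) \<otimes> b = (\<Oplus>k\<in>{..m}. ?f k \<otimes> b)"
    using a b by (intro finsum_ldistr) auto
  also have "\<dots> = (\<Oplus>k\<in>{..m}. ?h k)"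
    using a b by (intro finsum_cong') (auto simp: add_pow_ldistr add_pow_rdistr m_ac Suc_diff_le)
  also have "\<dots> = (\<Oplus>k\<in>{..Suc m}. ?h k)"
    using a b by (subst finsum_Suc) (auto simp: binomial_eq_0)
  also have "\<dots> = (\<Oplus>k\<in>{..m}. ?h (Suc k)) \<oplus> ?h 0"
    using a b by (intro finsum_Suc2) auto
  finally have B: "(\<Oplus>k\<in>{..m}. ?f k) \<otimes> b = (\<Oplus>k\<in>{..m}. ?h (Suc k)) \<oplus> ?h 0" .
  have "(a \<oplus> b) [^] Suc m = (\<Oplus>k\<in>{..m}. ?f k) \<otimes> a \<oplus> (\<Oplus>k\<in>{..m}. ?f k) \<otimes> b"
    using a b by (simp add: Suc.IH r_distr)
  also have "\<dots> = ((\<Oplus>k\<in>{..m}. ?g k) \<oplus> (\<Oplus>k\<in>{..m}. ?h (Suc k))) \<oplus> ?h 0"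
    unfolding A B using a b by (intro a_assoc [symmetric]) auto
  also have "(\<Oplus>k\<in>{..m}. ?g k) \<oplus> (\<Oplus>k\<in>{..m}. ?h (Suc k)) = (\<Oplus>k\<in>{..m}. ?g k \<oplus> ?h (Suc k))"
    using a b by (intro finsum_addf [symmetric]) auto
  also have "\<dots> = (\<Oplus>k\<in>{..m}. ?t (Suc k))"
    using a b by (intro finsum_cong') (auto simp: add.nat_pow_mult)
  also have "\<dots> \<oplus> ?h 0 = (\<Oplus>k\<in>{..m}. ?t (Suc k)) \<oplus> ?t 0"
    by simp
  also have "\<dots> = (\<Oplus>k\<in>{..Suc m}. ?t k)"
    using a b by (intro finsum_Suc2 [symmetric]) auto
  finally show ?case .
qed

lemma add_pow_char_dvd:
  fixes p m :: nat
  assumes "add_pow R p \<one> = \<zero>" "p dvd m" "x \<in> carrier R"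
  shows "add_pow R m x = \<zero>"
proof -
  from assms(2) obtain k where m: "m = p * k" ..
  have "add_pow R p x = add_pow R p (\<one> \<otimes> x)" using assms by simp
  also have "\<dots> = (add_pow R p \<one>) \<otimes> x" using assms by (intro add_pow_ldistr [symmetric]) auto
  finally have "add_pow R p x = \<zero>" using assms by simp
  then show ?thesis using assms m by (simp add: add.nat_pow_pow [symmetric])
qed

lemma frobenius_add:
  assumes p: "Factorial_Ring.prime p" "add_pow R (p::nat) \<one> = \<zero>" and a: "a \<in> carrier R" and b: "b \<in> carrier R"
  shows "(a \<oplus> b) [^] (p ^ e) = a [^] (p ^ e) \<oplus> b [^] (p ^ e)"
proof (induction e)
  case 0
  then show ?case using a b by simp
next
  case (Suc e)
  have *: "(x \<oplus> y) [^] p = x [^] p \<oplus> y [^] p" if x: "x \<in> carrier R" and y: "y \<in> carrier R" for x y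
  proof -
    let ?t = "\<lambda>k. add_pow R (p choose k) (x [^] k \<otimes> y [^] (p - k))"
    obtain r where r: "p = Suc r" using prime_gt_0_nat [OF p(1)] by (cases p) auto
    have r0: "r > 0" using prime_gt_1_nat [OF p(1)] r by simp
    have "(\<Oplus>k\<in>{..r}. ?t k) = (\<Oplus>k\<in>{..r}. if 0 = k then y [^] p else \<zero>)"
    proof (rule finsum_cong')
      fix k assume k: "k \<in> {..r}"
      show "?t k = (if 0 = k then y [^] p else \<zero>)"
      proof (cases "k = 0")
        case False
        then have "p dvd (p choose k)"
          using k r p(1) by (intro dvd_choose_prime) auto
        then show ?thesis using False x y by (simp add: add_pow_char_dvd [OF p(2)])
      qed (use y in simp)
    qed (use y in auto)
    also have "\<dots> = y [^] p"
      using y finsum_singleton [of 0 "{..r}" "\<lambda>_. y [^] p"] by (simp del: if_cancel cong: if_cong)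
    finally have 1: "(\<Oplus>k\<in>{..r}. ?t k) = y [^] p" .
    have "(x \<oplus> y) [^] p = (\<Oplus>k\<in>{..Suc r}. ?t k)"
      using binomial_cring [OF x y, of p] r by simp
    also have "\<dots> = ?t (Suc r) \<oplus> (\<Oplus>k\<in>{..r}. ?t k)"
      using x y by (intro finsum_Suc) auto
    finally show ?thesis using x y 1 r by simp
  qed
  have pw: "x [^] (p ^ Suc e) = (x [^] (p ^ e)) [^] p" if "x \<in> carrier R" for x
    using that by (simp add: nat_pow_pow mult.commute)
  show ?case using a b by (simp add: pw Suc.IH * del: power_Suc)
qed

lemma frobenius_power_mono:
  assumes p: "Factorial_Ring.prime p" "add_pow R (p::nat) \<one> = \<zero>" and A: "A \<subseteq> carrier R" and B: "B \<subseteq> carrier R"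
    and sub: "Idl A \<subseteq> Idl B"
  shows "Idl ((\<lambda>a. a [^] (p ^ e)) ` A) \<subseteq> Idl ((\<lambda>a. a [^] (p ^ e)) ` B)"
proof -
  let ?q = "p ^ e"
  let ?J = "Idl ((\<lambda>a. a [^] ?q) ` B)"
  have JB: "(\<lambda>a. a [^] ?q) ` B \<subseteq> carrier R" using B by auto
  interpret J: ideal ?J R using JB by (rule genideal_ideal)
  let ?K = "{x \<in> carrier R. x [^] ?q \<in> ?J}"
  have q: "?q > 0" using prime_gt_0_nat [OF p(1)] by simp
  have minus: "\<ominus> x = (\<ominus> \<one>) \<otimes> x" if "x \<in> carrier R" for x
    using that by (simp add: l_minus)
  have K: "ideal ?K R"
  proof (rule idealI)
    show "subgroup ?K (add_monoid R)"
    proof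
      show "\<one>\<^bsub>add_monoid R\<^esub> \<in> ?K" using q by (simp add: nat_pow_zero)
      fix x assume x: "x \<in> ?K"
      have "(\<ominus> x) [^] ?q = (\<ominus> \<one>) [^] ?q \<otimes> x [^] ?q"
        using x by (subst minus) (auto simp: nat_pow_distrib)
      then show "inv\<^bsub>add_monoid R\<^esub> x \<in> ?K"
        using x J.I_l_closed [of "x [^] ?q" "(\<ominus> \<one>) [^] ?q"]
        by (simp add: a_inv_def [symmetric])
    qed (auto simp: frobenius_add [OF p])
  qed (auto intro: ring_axioms simp: nat_pow_distrib J.I_l_closed J.I_r_closed)
  have "B \<subseteq> ?K" using B genideal_self [OF JB] by auto
  then have "Idl B \<subseteq> ?K" by (rule genideal_minimal [OF K])
  then have "A \<subseteq> ?K" using genideal_self [OF A] sub by blast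
  then show ?thesis by (intro genideal_minimal J.is_ideal) auto
qed

lemma frobenius_power_genideal:
  assumes p: "Factorial_Ring.prime p" "add_pow R (p::nat) \<one> = \<zero>" and A: "finite A" "A \<subseteq> carrier R"
  shows "frobenius_power R (Idl A) (p ^ e) = Idl ((\<lambda>a. a [^] (p ^ e)) ` A)"
  unfolding frobenius_power_def
proof (rule the_equality)
  fix J assume "\<exists>B. finite B \<and> B \<subseteq> carrier R \<and> Idl A = Idl B \<and> J = Idl ((\<lambda>a. a [^] (p ^ e)) ` B)"
  then obtain B where B: "B \<subseteq> carrier R" "Idl A = Idl B" "J = Idl ((\<lambda>a. a [^] (p ^ e)) ` B)" by blast
  then show "J = Idl ((\<lambda>a. a [^] (p ^ e)) ` A)"
    using frobenius_power_mono [OF p, of A B] frobenius_power_mono [OF p, of B A] A by blast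
qed (use A in blast)

end


section \<open>The ring \<open>K[X\<^sub>1, \<dots>, X\<^sub>n]/(X\<^sub>1\<^sup>n + \<dots> + X\<^sub>n\<^sup>n)\<close>\<close>

text \<open>
  Polynomials are finitely supported maps from exponent vectors to coefficients, with the
  convolution product of \<^theory>\<open>HOL-Library.Poly_Mapping\<close>; the type has one variable for
  every natural number, and the carrier keeps those polynomials in which only the variables
  with index in \<open>{1..n}\<close> occur.
\<close>

definition mpoly_ring :: "nat \<Rightarrow> ((nat \<Rightarrow>\<^sub>0 nat) \<Rightarrow>\<^sub>0 'k::field) ring"
  where "mpoly_ring n = ring_of_type_algebra
    \<lparr>carrier := {f. \<forall>m \<in> Poly_Mapping.keys f. Poly_Mapping.keys m \<subseteq> {1..n}}\<rparr>"

definition mpoly_var :: "nat \<Rightarrow> ((nat \<Rightarrow>\<^sub>0 nat) \<Rightarrow>\<^sub>0 'k::field)"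
  where "mpoly_var i = Poly_Mapping.single (Poly_Mapping.single i 1) 1"

definition diagonal_ideal :: "nat \<Rightarrow> ((nat \<Rightarrow>\<^sub>0 nat) \<Rightarrow>\<^sub>0 'k::field) set"
  where "diagonal_ideal n = Idl\<^bsub>mpoly_ring n\<^esub> {\<Sum>i = 1..n. mpoly_var i ^ n}"

definition diagonal_ring :: "nat \<Rightarrow> ((nat \<Rightarrow>\<^sub>0 nat) \<Rightarrow>\<^sub>0 'k::field) set ring"
  where "diagonal_ring n = mpoly_ring n Quot diagonal_ideal n"

definition diagonal_var :: "nat \<Rightarrow> nat \<Rightarrow> ((nat \<Rightarrow>\<^sub>0 nat) \<Rightarrow>\<^sub>0 'k::field) set"
  where "diagonal_var n i = diagonal_ideal n +>\<^bsub>mpoly_ring n\<^esub> mpoly_var i"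

lemma cring_mpoly_ring: "cring (mpoly_ring n)"
proof -
  interpret T: cring "ring_of_type_algebra :: ((nat \<Rightarrow>\<^sub>0 nat) \<Rightarrow>\<^sub>0 'a) ring"
    by (rule cring_from_type_algebra)
  let ?T = "ring_of_type_algebra :: ((nat \<Rightarrow>\<^sub>0 nat) \<Rightarrow>\<^sub>0 'a) ring"
  let ?C = "{f :: (nat \<Rightarrow>\<^sub>0 nat) \<Rightarrow>\<^sub>0 'a. \<forall>m \<in> Poly_Mapping.keys f. Poly_Mapping.keys m \<subseteq> {1..n}}"
  have neg: "\<ominus>\<^bsub>?T\<^esub> f = - f" for f
    by (rule T.minus_equality) (auto simp: ring_of_type_algebra_def)
  have "subcring ?C ?T"
  proof (rule T.subcringI', rule T.subringI)
    fix f g assume f: "f \<in> ?C" and g: "g \<in> ?C"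
    show "\<ominus>\<^bsub>?T\<^esub> f \<in> ?C" using f unfolding neg by (auto simp: in_keys_iff)
    show "f \<oplus>\<^bsub>?T\<^esub> g \<in> ?C"
      using f g keys_add [of f g] by (auto simp: ring_of_type_algebra_def)
    have "Poly_Mapping.keys m \<subseteq> {1..n}" if m: "m \<in> Poly_Mapping.keys (f * g)" for m
    proof -
      obtain a b where "m = a + b" "a \<in> Poly_Mapping.keys f" "b \<in> Poly_Mapping.keys g"
        using keys_mult [of f g] m by blast
      then show ?thesis using f g keys_add [of a b] by fast
    qed
    then show "f \<otimes>\<^bsub>?T\<^esub> g \<in> ?C" by (auto simp: ring_of_type_algebra_def)
  qed (auto simp: ring_of_type_algebra_def)
  then show ?thesis
    using T.subcring_iff [of ?C] by (simp add: mpoly_ring_def ring_of_type_algebra_def)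
qed

end

theory Submission
  imports Defs
begin

text \<open>
  Put \<open>y\<^sub>i = x\<^sub>i\<^sup>n\<close>, so that \<open>y\<^sub>1 + \<dots> + y\<^sub>n = 0\<close>, and let \<open>k\<close> be the integer part of \<open>q / n\<close>. Up to a
  multiplier \<open>c\<close> that is a fixed power of \<open>x\<^sub>1 \<cdots> x\<^sub>n\<close>, and hence a nonzerodivisor, the claim says that
  \<open>(y\<^sub>1 \<cdots> y\<^sub>n)\<close> to the power \<open>(n - 2) k\<close> lies in the ideal of the \<open>y\<^sub>i\<close> to the power \<open>(n - 1) k\<close>.

  The key is a fact about two variables in characteristic \<open>p\<close>: if \<open>\<alpha>, \<beta>, \<gamma> \<le> q\<close> and
  \<open>\<alpha> + \<beta> + \<gamma> \<le> 2 q\<close>, then the ideal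
  \<open>(x\<^sup>\<alpha>, y\<^sup>\<beta>, (y - x)\<^sup>\<gamma>)\<close> contains all monomials of degree \<open>q - 1\<close>. Indeed \<open>\<Sum> c(l) x\<^sup>l y\<^bsup>q-1-l\<^esup>\<close>,
  summed over \<open>l < q\<close>, is divisible by \<open>(y - x)\<^bsup>q-m\<^esup>\<close> whenever \<open>c\<close> is an integer-valued polynomial of
  degree less than \<open>m\<close>, and such a \<open>c\<close> takes arbitrary prescribed values at \<open>m\<close> consecutive integers.

  For \<open>n = 3\<close> this applies with \<open>\<alpha> = \<beta> = \<gamma> = 2 k\<close>. For \<open>n \<ge> 4\<close> the element \<open>w = y\<^sub>3 + \<dots> + y\<^sub>n\<close> satisfies
  \<open>w\<^bsup>(n-2)k\<^esup> (y\<^sub>3 \<cdots> y\<^sub>n)\<^bsup>(n-2)k\<^esup> \<in> (y\<^sub>3\<^bsup>(n-1)k\<^esup>, \<dots>, y\<^sub>n\<^bsup>(n-1)k\<^esup>)\<close> for degree reasons, and the fact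
  applied to \<open>y\<^sub>1 + y\<^sub>2 + w = 0\<close> disposes of \<open>y\<^sub>1\<close> and \<open>y\<^sub>2\<close>.
\<close>

section \<open>Binomial coefficients modulo a prime\<close>

text \<open>Since q = \<open>p ^ e\<close> divides \<open>k * (q choose k)\<close>, a binomial
  coefficient prime to p would force q to divide the smaller positive number k.\<close>

lemma prime_dvd_choose_prime_power:
  fixes p k e :: nat
  assumes p: "Factorial_Ring.prime p" and k: "0 < k" "k < p ^ e"
  shows "p dvd (p ^ e choose k)"
proof (rule ccontr)
  assume "\<not> p dvd (p ^ e choose k)"
  then have "coprime p (p ^ e choose k)" using p by (simp add: prime_imp_coprime)
  then have "coprime (p ^ e) (p ^ e choose k)" by simp
  moreover have "p ^ e dvd k * (p ^ e choose k)"
    using times_binomial_minus1_eq [OF k(1), of "p ^ e"] by simp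
  ultimately have "p ^ e dvd k" by (simp add: coprime_dvd_mult_left_iff)
  then show False using k by (simp add: nat_dvd_not_less)
qed

text \<open>By Pascal's rule, neighbours in row q - 1 add up to an inner entry of row q, which
  vanishes modulo p; so the signs alternate, starting from 1.\<close>

lemma choose_prime_power_minus_1_cong:
  fixes p l e :: nat
  assumes p: "Factorial_Ring.prime p" and l: "l < p ^ e"
  shows "int p dvd int (p ^ e - 1 choose l) - (- 1) ^ l"
  using l
proof (induction l)
  case (Suc l)
  have "p ^ e choose Suc l = (p ^ e - 1 choose l) + (p ^ e - 1 choose Suc l)"
    using Suc.prems by (cases "p ^ e") auto
  then have *: "int (p ^ e - 1 choose Suc l) - (- 1) ^ Suc l
      = int (p ^ e choose Suc l) - (int (p ^ e - 1 choose l) - (- 1) ^ l)"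
    by simp
  have "int p dvd int (p ^ e choose Suc l)"
    using prime_dvd_choose_prime_power [OF p, of "Suc l" e] Suc.prems by simp
  moreover have "int p dvd int (p ^ e - 1 choose l) - (- 1) ^ l" using Suc by simp
  ultimately show ?case unfolding * by (rule dvd_diff)
qed simp

text \<open>Trinomial revision moves the row from l to q - 1 - j; the two coefficients of row q - 1
  that it introduces are signs modulo p.\<close>

lemma choose_prime_power_reflect_cong:
  fixes p j l e :: nat
  assumes p: "Factorial_Ring.prime p" and jl: "j \<le> l" "l < p ^ e"
  shows "int p dvd (- 1) ^ (l - j) * int (p ^ e - 1 - j choose (l - j)) - int (l choose j)"
proof -
  let ?q = "p ^ e - 1"
  have eq: "int (?q choose l) * int (l choose j) = int (?q choose j) * int (?q - j choose (l - j))"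
    using choose_mult [of j l ?q] jl by (simp flip: of_nat_mult)
  have A: "int p dvd (int (?q choose l) - (- 1) ^ l) * int (l choose j)"
    using choose_prime_power_minus_1_cong [OF p jl(2)] by simp
  have B: "int p dvd (int (?q choose j) - (- 1) ^ j) * int (?q - j choose (l - j))"
    using choose_prime_power_minus_1_cong [OF p, of j e] jl by simp
  have "int p dvd (- 1) ^ j * int (?q - j choose (l - j)) - (- 1) ^ l * int (l choose j)"
    using dvd_diff [OF A B] by (simp only: left_diff_distrib eq) (simp add: algebra_simps)
  then have "int p dvd (- 1) ^ l * ((- 1) ^ j * int (?q - j choose (l - j)) - (- 1) ^ l * int (l choose j))"
    by (rule dvd_mult)
  also have "\<dots> = (- 1) ^ (l + j) * int (?q - j choose (l - j)) - (- 1) ^ (l + l) * int (l choose j)"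
    by (simp add: algebra_simps power_add)
  also have "(- 1 :: int) ^ (l + j) = (- 1) ^ (l - j)"
    using jl by (simp add: uminus_power_if)
  finally show ?thesis by simp
qed

lemma of_int_eq_of_char_dvd:
  fixes a b :: int
  assumes "(of_nat p :: 'a::comm_ring_1) = 0" "int p dvd a - b"
  shows "(of_int a :: 'a) = of_int b"
proof -
  obtain k where "a - b = int p * k" using assms(2) ..
  then have "(of_int a :: 'a) - of_int b = of_nat p * of_int k"
    by (metis of_int_diff of_int_mult of_int_of_nat_eq)
  then show ?thesis using assms(1) by simp
qed

text \<open>This is the expansion of \<open>x\<^sup>j (1 - x)\<^sup>q / (1 - x)\<^bsup>j+1\<^esup>\<close>, homogenised.\<close>

lemma power_mult_diff_power_char:
  fixes x y :: "'a::comm_ring_1" and p e :: nat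
  assumes p: "Factorial_Ring.prime p" "(of_nat p :: 'a) = 0" and j: "j < p ^ e"
  shows "x ^ j * (y - x) ^ (p ^ e - 1 - j)
    = (\<Sum>l<p ^ e. of_nat (l choose j) * x ^ l * y ^ (p ^ e - 1 - l))"
proof -
  define q where "q = p ^ e"
  have jq: "j < q" using j by (simp add: q_def)
  have "x ^ j * (y - x) ^ (q - 1 - j)
      = x ^ j * (\<Sum>r\<le>q - 1 - j. of_nat (q - 1 - j choose r) * (- x) ^ r * y ^ (q - 1 - j - r))"
    by (subst binomial_ring [symmetric]) simp
  also have "\<dots> = (\<Sum>r\<le>q - 1 - j. of_int ((- 1) ^ r * int (q - 1 - j choose r))
      * x ^ (j + r) * y ^ (q - 1 - (j + r)))"
    unfolding sum_distrib_left
  proof (rule sum.cong)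
    fix r
    show "x ^ j * (of_nat (q - 1 - j choose r) * (- x) ^ r * y ^ (q - 1 - j - r))
      = of_int ((- 1) ^ r * int (q - 1 - j choose r)) * x ^ (j + r) * y ^ (q - 1 - (j + r))"
      using power_minus [of x r] by (simp add: power_add mult_ac)
  qed simp
  also have "\<dots> = (\<Sum>l = j..<q. of_int ((- 1) ^ (l - j) * int (q - 1 - j choose (l - j)))
      * x ^ l * y ^ (q - 1 - l))"
    by (rule sum.reindex_bij_witness [of _ "\<lambda>l. l - j" "\<lambda>r. j + r"]) (use jq in auto)
  also have "\<dots> = (\<Sum>l = j..<q. of_nat (l choose j) * x ^ l * y ^ (q - 1 - l))"
  proof (rule sum.cong)
    fix l assume "l \<in> {j..<q}"
    then have "(of_int ((- 1) ^ (l - j) * int (q - 1 - j choose (l - j))) :: 'a)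
      = of_int (int (l choose j))"
      using choose_prime_power_reflect_cong [OF p(1), of j l e]
      by (intro of_int_eq_of_char_dvd [OF p(2)]) (auto simp: q_def)
    then show "of_int ((- 1) ^ (l - j) * int (q - 1 - j choose (l - j))) * x ^ l * y ^ (q - 1 - l)
      = of_nat (l choose j) * x ^ l * y ^ (q - 1 - l)" by simp
  qed simp
  also have "\<dots> = (\<Sum>l<q. of_nat (l choose j) * x ^ l * y ^ (q - 1 - l))"
    by (rule sum.mono_neutral_left) (auto simp: binomial_eq_0)
  finally show ?thesis by (simp add: q_def)
qed

text \<open>Newton's forward differences: \<open>t choose Suc j\<close> has difference
  \<open>t choose j\<close>, so an interpolant of the differences of v at m points sums up to one of
  v at m + 1 points, and the coefficients stay integral.\<close>

lemma newton_interpolation_int: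
  fixes v :: "nat \<Rightarrow> int"
  shows "\<exists>a :: nat \<Rightarrow> int. \<forall>r<m. (\<Sum>j<m. a j * int (s + r choose j)) = v r"
proof (induction m arbitrary: v)
  case (Suc m)
  obtain a :: "nat \<Rightarrow> int" where a: "\<And>r. r < m \<Longrightarrow> (\<Sum>j<m. a j * int (s + r choose j)) = v (Suc r) - v r"
    using Suc.IH [of "\<lambda>r. v (Suc r) - v r"] by blast
  \<comment> \<open>Summation shifts the coefficients by one place; \<open>b 0\<close> is the
    constant that produces \<open>v 0\<close> at s.\<close>
  define b where "b j = (case j of 0 \<Rightarrow> v 0 - (\<Sum>j<m. a j * int (s choose Suc j)) | Suc i \<Rightarrow> a i)" for j
  have split: "(\<Sum>j<Suc m. b j * int (t choose j)) = b 0 + (\<Sum>j<m. a j * int (t choose Suc j))" for t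
    by (subst sum.lessThan_Suc_shift) (simp add: b_def)
  have "(\<Sum>j<Suc m. b j * int (s + r choose j)) = v r" if "r < Suc m" for r
    using that
  proof (induction r)
    case 0
    then show ?case unfolding split by (simp add: b_def)
  next
    case (Suc r)
    then show ?case using a [of r] unfolding split
      by (simp add: algebra_simps sum.distrib)
  qed
  then show ?case by blast
qed simp

section \<open>Membership in ideals of prime characteristic\<close>

text \<open>Ideals of a type-class ring, where sums, powers and divisibility of the class are at
  hand; ideals of the quotient ring are pulled back to this form.\<close>

locale type_ideal =
  fixes J :: "'a::comm_ring_1 set"
  assumes zero_mem: "0 \<in> J"
    and add_mem: "a \<in> J \<Longrightarrow> b \<in> J \<Longrightarrow> a + b \<in> J"
    and mult_mem: "b \<in> J \<Longrightarrow> a * b \<in> J"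
begin

lemma mult_mem_right: "a \<in> J \<Longrightarrow> a * b \<in> J"
  using mult_mem [of a b] by (simp add: mult.commute)

lemma minus_mem: "a \<in> J \<Longrightarrow> b \<in> J \<Longrightarrow> a - b \<in> J"
  using add_mem [of a "- 1 * b"] mult_mem [of b "- 1"] by simp

lemma sum_mem: "(\<And>i. i \<in> S \<Longrightarrow> f i \<in> J) \<Longrightarrow> sum f S \<in> J"
  by (induction S rule: infinite_finite_induct) (auto simp: zero_mem add_mem)

lemma dvd_mem: "a \<in> J \<Longrightarrow> a dvd b \<Longrightarrow> b \<in> J"
  by (metis dvdE mult.commute mult_mem)

lemma power_mem: "a ^ m \<in> J \<Longrightarrow> m \<le> n \<Longrightarrow> a ^ n \<in> J"
  by (rule dvd_mem) (auto intro: le_imp_power_dvd)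

text \<open>Multipliers are carried along by passing to a colon ideal, in which the lemmas of this
  locale apply again.\<close>

lemma colon: "type_ideal {a. a * b \<in> J}"
  by unfold_locales (auto simp: zero_mem add_mem distrib_right mult.assoc mult_mem)

section \<open>Monomials of degree at least q - 1 in two variables\<close>

text \<open>With q = \<open>p ^ e\<close>, interpolation handles the q - \<gamma> exponents of x
  just below \<alpha>. The bound \<open>p ^ e \<le> \<alpha> + \<gamma>\<close> keeps this window
  nonnegative, and \<open>\<alpha> + \<beta> + \<gamma> \<le> 2 * p ^ e\<close> makes the exponent
  of y at least \<beta> to the left of it.\<close>

lemma monomial_mem:
  fixes x y :: 'a and p e :: nat
  assumes p: "Factorial_Ring.prime p" "(of_nat p :: 'a) = 0"
    and b: "\<alpha> \<le> p ^ e" "\<gamma> \<le> p ^ e" "p ^ e \<le> \<alpha> + \<gamma>" "\<alpha> + \<beta> + \<gamma> \<le> 2 * p ^ e"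
    and J: "x ^ \<alpha> \<in> J" "y ^ \<beta> \<in> J" "(y - x) ^ \<gamma> \<in> J"
    and ij: "p ^ e \<le> Suc (i + j)"
  shows "x ^ i * y ^ j \<in> J"
proof -
  define q where "q = p ^ e"
  define m where "m = q - \<gamma>"
  have q0: "q > 0" using prime_gt_0_nat [OF p(1)] by (simp add: q_def)
  have main: "x ^ i * y ^ (q - 1 - i) \<in> J" if i: "i < q" for i
  proof -
    consider "\<alpha> \<le> i" | "i < \<alpha> - m" | "\<alpha> - m \<le> i" "i < \<alpha>" by linarith
    then show ?thesis
    proof cases
      case 1
      then show ?thesis using J(1) by (metis mult.commute mult_mem power_mem)
    next
      case 2
      then have "\<beta> \<le> q - 1 - i" using b by (simp add: m_def q_def)
      then show ?thesis using J(2) by (metis mult_mem power_mem)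
    next
      case 3
      (* Choose the coefficients c so that x^i y^(q-1-i) is the only monomial in S with exponents
         l in the window from \<alpha> - m to \<alpha> - 1; all monomials outside it are divisible by
         x^\<alpha> or y^\<beta>. *)
      define s where "s = \<alpha> - m"
      have sm: "s + m = \<alpha>" using b by (simp add: s_def m_def q_def)
      obtain a :: "nat \<Rightarrow> int" where
        a: "\<And>r. r < m \<Longrightarrow> (\<Sum>j<m. a j * int (s + r choose j)) = (if s + r = i then 1 else 0)"
        using newton_interpolation_int [of m s "\<lambda>r. if s + r = i then 1 else 0"] by blast
      define c where "c l = (\<Sum>j<m. a j * int (l choose j))" for l
      have c: "c l = (if l = i then 1 else 0)" if "s \<le> l" "l < \<alpha>" for l
        using a [of "l - s"] that sm by (simp add: c_def)
      define S where "S = (\<Sum>l<q. of_int (c l) * x ^ l * y ^ (q - 1 - l))"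
      \<comment> \<open>Expanding c in binomial coefficients turns S into a combination of the
        elements \<open>x ^ j * (y - x) ^ (q - 1 - j)\<close> with j < m, and then q - 1 - j is at
        least \<gamma>.\<close>
      have "S = (\<Sum>l<q. \<Sum>j<m. of_int (a j) * (of_nat (l choose j) * x ^ l * y ^ (q - 1 - l)))"
        by (simp add: S_def c_def sum_distrib_left sum_distrib_right mult_ac)
      also have "\<dots> = (\<Sum>j<m. of_int (a j) * (\<Sum>l<q. of_nat (l choose j) * x ^ l * y ^ (q - 1 - l)))"
        by (subst sum.swap) (simp add: sum_distrib_left)
      also have "\<dots> = (\<Sum>j<m. of_int (a j) * (x ^ j * (y - x) ^ (q - 1 - j)))"
      proof (rule sum.cong)
        fix j assume "j \<in> {..<m}"
        then have "j < p ^ e" by (simp add: m_def q_def)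
        then show "of_int (a j) * (\<Sum>l<q. of_nat (l choose j) * x ^ l * y ^ (q - 1 - l))
            = of_int (a j) * (x ^ j * (y - x) ^ (q - 1 - j))"
          using power_mult_diff_power_char [OF p, of j e x y] by (simp add: q_def)
      qed simp
      also have "\<dots> \<in> J"
      proof (intro sum_mem mult_mem)
        fix j assume "j \<in> {..<m}"
        then have "\<gamma> \<le> q - 1 - j" by (auto simp: m_def)
        then show "(y - x) ^ (q - 1 - j) \<in> J" using J(3) by (rule power_mem [rotated])
      qed
      finally have SJ: "S \<in> J" .
      have "S = of_int (c i) * x ^ i * y ^ (q - 1 - i)
          + (\<Sum>l\<in>{..<q} - {i}. of_int (c l) * x ^ l * y ^ (q - 1 - l))"
        unfolding S_def using i by (intro sum.remove) auto
      also have "c i = 1" using c [of i] 3 by (simp add: s_def)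
      finally have S: "x ^ i * y ^ (q - 1 - i)
          = S - (\<Sum>l\<in>{..<q} - {i}. of_int (c l) * x ^ l * y ^ (q - 1 - l))" by simp
      have "of_int (c l) * x ^ l * y ^ (q - 1 - l) \<in> J" if l: "l \<in> {..<q} - {i}" for l
      proof -
        consider "\<alpha> \<le> l" | "l < s" | "s \<le> l" "l < \<alpha>" by linarith
        then show ?thesis
        proof cases
          case 1
          then have "x ^ l \<in> J" using J(1) by (rule power_mem [rotated])
          then show ?thesis by (rule dvd_mem) simp
        next
          case 2
          then have "\<beta> \<le> q - 1 - l" using b by (simp add: s_def m_def q_def)
          then have "y ^ (q - 1 - l) \<in> J" using J(2) by (rule power_mem [rotated])
          then show ?thesis by (rule dvd_mem) simp
        next
          case 3
          then show ?thesis using c l by (simp add: zero_mem)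
        qed
      qed
      then show ?thesis unfolding S by (intro minus_mem SJ sum_mem)
    qed
  qed
  \<comment> \<open>In higher degree it suffices to find a divisor of degree exactly q - 1.\<close>
  define k where "k = min i (q - 1)"
  have "x ^ k * y ^ (q - 1 - k) \<in> J" using main [of k] q0 by (simp add: k_def)
  then show ?thesis
    by (rule dvd_mem) (intro mult_dvd_mono le_imp_power_dvd; use ij in \<open>simp add: k_def q_def\<close>)
qed

section \<open>Powers of a product of elements whose sum lies in the ideal\<close>

text \<open>Multiplying out one factor of the sum raises one exponent by 1. When no factor is left,
  the exponents add up to more than \<open>card S * (N - 1)\<close>, so one of them is at least
  N.\<close>

lemma sum_power_mult_prod_mem:
  assumes "finite S" "\<And>i. i \<in> S \<Longrightarrow> y i ^ N \<in> J" "card S * (N - 1) < s + sum a S"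
  shows "(\<Sum>i\<in>S. y i) ^ s * (\<Prod>i\<in>S. y i ^ a i) \<in> J"
  using assms(3)
proof (induction s arbitrary: a)
  case 0
  have "\<exists>i\<in>S. N \<le> a i"
  proof (rule ccontr)
    assume "\<not> (\<exists>i\<in>S. N \<le> a i)"
    then have "sum a S \<le> (\<Sum>i\<in>S. N - 1)" by (intro sum_mono) auto
    then show False using 0 by simp
  qed
  then obtain i where i: "i \<in> S" "N \<le> a i" by blast
  then have "y i ^ a i \<in> J" using assms(2) power_mem by blast
  moreover have "y i ^ a i dvd (\<Prod>i\<in>S. y i ^ a i)"
    using i assms(1) by (intro dvd_prodI) auto
  ultimately show ?case using dvd_mem by simp
next
  case (Suc s)
  have "(\<Sum>i\<in>S. y i) ^ Suc s * (\<Prod>i\<in>S. y i ^ a i)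
      = (\<Sum>k\<in>S. (\<Sum>i\<in>S. y i) ^ s * (y k * (\<Prod>i\<in>S. y i ^ a i)))"
    by (simp add: sum_distrib_left sum_distrib_right mult_ac)
  also have "\<dots> \<in> J"
  proof (rule sum_mem)
    fix k assume k: "k \<in> S"
    have "y k * (\<Prod>i\<in>S. y i ^ a i) = (\<Prod>i\<in>S. y i ^ (a(k := Suc (a k))) i)"
      using k assms(1) by (subst (1 2) prod.remove [of S k]) (auto simp: mult_ac intro!: prod.cong arg_cong [where f = "(*) _"])
    moreover have "sum (a(k := Suc (a k))) S = Suc (sum a S)"
      using k assms(1) by (subst (1 2) sum.remove [of S k]) auto
    ultimately show "(\<Sum>i\<in>S. y i) ^ s * (y k * (\<Prod>i\<in>S. y i ^ a i)) \<in> J"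
      using Suc.IH [of "a(k := Suc (a k))"] Suc.prems by simp
  qed
  finally show ?case .
qed

lemma power_cong_mem:
  assumes "a - b \<in> J" "b ^ m \<in> J"
  shows "a ^ m \<in> J"
proof -
  have "a ^ m - b ^ m \<in> J"
    using assms(1) by (rule dvd_mem) (simp add: power_diff_sumr2)
  then show ?thesis using add_mem [OF _ assms(2)] by fastforce
qed

lemma uminus_power_mem: "(- a) ^ m \<in> J \<longleftrightarrow> a ^ m \<in> J"
  using mult_mem [of "a ^ m" "- 1"] mult_mem [of "- (a ^ m)" "- 1"] by (auto simp: uminus_power_if)

text \<open>Modulo J, z equals u - x with u = - y, so up to sign the power becomes
  \<open>(u - x) ^ a * (x * u) ^ a\<close>, a form of degree 3 a in x and u. As 3 a is at least q -
  1, \<open>monomial_mem\<close> with all three exponents equal to 2 k covers each of its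
  monomials.\<close>

lemma prod_power_mem_three:
  fixes x y z :: 'a and p e k a :: nat
  assumes p: "Factorial_Ring.prime p" "(of_nat p :: 'a) = 0"
    and k: "3 * k \<le> p ^ e" "p ^ e \<le> 4 * k" "p ^ e \<le> Suc (3 * a)"
    and sum: "x + y + z \<in> J"
    and J: "x ^ (2 * k) \<in> J" "y ^ (2 * k) \<in> J" "z ^ (2 * k) \<in> J"
  shows "(x * y * z) ^ a \<in> J"
proof -
  define u where "u = - y"
  have uz: "(u - x) - z \<in> J"
    using mult_mem [OF sum, of "- 1"] by (simp add: u_def diff_diff_add ac_simps)
  have zu: "z - (u - x) \<in> J"
    using mult_mem [OF uz, of "- 1"] by simp
  have mono: "x ^ i * u ^ j \<in> J" if "p ^ e \<le> Suc (i + j)" for i j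
  proof (rule monomial_mem [OF p, where \<alpha> = "2 * k" and \<gamma> = "2 * k" and \<beta> = "2 * k"])
    show "(u - x) ^ (2 * k) \<in> J" using uz J(3) by (rule power_cong_mem)
  qed (use J k that in \<open>auto simp: u_def uminus_power_mem\<close>)
  have "(u - x) ^ a * (x * u) ^ a
      = (\<Sum>r\<le>a. of_nat (a choose r) * u ^ r * (- x) ^ (a - r) * (x * u) ^ a)"
    by (subst binomial_ring [of u "- x" a, simplified]) (simp add: sum_distrib_right)
  also have "\<dots> \<in> J"
  proof (rule sum_mem)
    fix r assume "r \<in> {..a}"
    then have "x ^ (a - r + a) * u ^ (r + a) \<in> J" using k by (intro mono) auto
    moreover have "of_nat (a choose r) * u ^ r * (- x) ^ (a - r) * (x * u) ^ a
        = of_nat (a choose r) * (- 1) ^ (a - r) * (x ^ (a - r + a) * u ^ (r + a))"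
      by (subst power_minus) (simp add: power_add power_mult_distrib mult_ac)
    ultimately show "of_nat (a choose r) * u ^ r * (- x) ^ (a - r) * (x * u) ^ a \<in> J"
      by (metis mult_mem)
  qed
  finally have *: "(u - x) ^ a * (x * u) ^ a \<in> J" .
  \<comment> \<open>In the colon ideal, \<open>z ^ a\<close> alone can be exchanged for
    \<open>(u - x) ^ a\<close>.\<close>
  interpret C: type_ideal "{b. b * (x * u) ^ a \<in> J}" by (rule colon)
  have "z ^ a \<in> {b. b * (x * u) ^ a \<in> J}"
    using * mult_mem [OF zu, of "(x * u) ^ a"]
    by (intro C.power_cong_mem [of z "u - x"]) (simp_all add: mult_ac)
  then have "(- (x * y * z)) ^ a \<in> J"
    by (simp add: u_def power_mult_distrib [symmetric] mult_ac)
  then show ?thesis by (simp only: uminus_power_mem)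
qed

text \<open>
  Modulo \<open>J : (y\<^sub>3 \<cdots> y\<^sub>n)\<^sup>a\<close> the form \<open>y\<^sub>1 + y\<^sub>2 = - (y\<^sub>3 + \<cdots> + y\<^sub>n)\<close> is nilpotent of order at most
  \<open>(n - 2) k\<close> by the pigeonhole principle, so only two variables remain.
\<close>

lemma prod_power_mem_ge_four:
  fixes y :: "nat \<Rightarrow> 'a" and p e k n a :: nat
  assumes p: "Factorial_Ring.prime p" "(of_nat p :: 'a) = 0"
    and n: "n \<ge> 4" and k: "k > 0" "n * k \<le> p ^ e" "p ^ e \<le> (n + 1) * k"
    and a: "(n - 2) * k \<le> a" "p ^ e + (n - 4) * k \<le> Suc (2 * a)"
    and sum: "(\<Sum>i = 1..n. y i) \<in> J"
    and J: "\<And>i. i \<in> {1..n} \<Longrightarrow> y i ^ ((n - 1) * k) \<in> J"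
  shows "(\<Prod>i = 1..n. y i) ^ a \<in> J"
proof -
  obtain m where m: "n = m + 4" using n that [of "n - 4"] by simp
  define A where "A = (\<Prod>i = 3..n. y i ^ a)"
  define w where "w = (\<Sum>i = 3..n. y i)"
  define u where "u = - y 2"
  have I: "{1..n} = insert 1 (insert 2 {3..n})" using n by auto
  define J2 where "J2 = {b. b * A \<in> J}"
  interpret J2: type_ideal J2 unfolding J2_def by (rule colon)
  have JJ2: "b \<in> J2" if "b \<in> J" for b
    using that by (simp add: J2_def mult_mem_right)
  have "w ^ ((n - 2) * k) \<in> J2"
    unfolding J2_def w_def A_def mem_Collect_eq
  proof (rule sum_power_mult_prod_mem [where N = "(n - 1) * k"])
    \<comment> \<open>The pigeonhole count, with n - 2 = m + 2 variables: it rests on (n - 1) k = k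
      + (n - 2) k and a \<ge> (n - 2) k, while k > 0 gives strictness.\<close>
    have "(m + 2) * ((m + 3) * k - 1) < (m + 2) * ((m + 3) * k)"
      using k by (intro mult_strict_left_mono) auto
    also have "(m + 2) * ((m + 3) * k) = (m + 2) * k + (m + 2) * ((m + 2) * k)"
      by (simp add: algebra_simps)
    also have "\<dots> \<le> (m + 2) * k + (m + 2) * a"
      using a m by (intro add_mono mult_le_mono) auto
    finally show "card {3..n} * ((n - 1) * k - 1) < (n - 2) * k + (\<Sum>i = 3..n. a)"
      using m by (simp add: add.commute)
  qed (use J in auto)
  moreover have "(\<Sum>i = 1..n. y i) = y 1 + (y 2 + w)"
    unfolding I by (simp add: w_def)
  then have "(u - y 1) - w = - 1 * (\<Sum>i = 1..n. y i)"
    by (simp add: u_def)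
  then have "(u - y 1) - w \<in> J2"
    using JJ2 [OF mult_mem [OF sum, of "- 1"]] by simp
  ultimately have u: "(u - y 1) ^ ((n - 2) * k) \<in> J2" by (blast intro: J2.power_cong_mem)
  \<comment> \<open>Dividing out \<open>y 1 ^ ((n - 4) * k)\<close> lowers the exponent of
    \<open>y 1\<close> from (n - 1) k to 3 k. Then 3 k, (n - 1) k and (n - 2) k add up to 2 n k
    \<le> 2 q, as \<open>monomial_mem\<close> demands.\<close>
  define J3 where "J3 = {b. b * y 1 ^ ((n - 4) * k) \<in> J2}"
  interpret J3: type_ideal J3 unfolding J3_def by (rule J2.colon)
  have J23: "b \<in> J3" if "b \<in> J2" for b
    using that by (simp add: J3_def J2.mult_mem_right)
  have "y 1 ^ (a - (n - 4) * k) * u ^ a \<in> J3"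
  proof (rule J3.monomial_mem [OF p, where \<alpha> = "3 * k" and \<beta> = "(n - 1) * k" and \<gamma> = "(n - 2) * k"])
    have "y 1 ^ (3 * k) * y 1 ^ ((n - 4) * k) = y 1 ^ ((n - 1) * k)"
      by (simp add: m algebra_simps flip: power_add)
    then show "y 1 ^ (3 * k) \<in> J3"
      using JJ2 [OF J, of 1] n by (simp add: J3_def)
    show "u ^ ((n - 1) * k) \<in> J3"
      using J23 [OF JJ2 [OF J, of 2]] n by (simp add: u_def J3.uminus_power_mem)
    show "(u - y 1) ^ ((n - 2) * k) \<in> J3" using u by (rule J23)
    show "p ^ e \<le> Suc (a - (n - 4) * k + a)" using a by linarith
    show "3 * k \<le> p ^ e" "(n - 2) * k \<le> p ^ e" "p ^ e \<le> 3 * k + (n - 2) * k"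
      "3 * k + (n - 1) * k + (n - 2) * k \<le> 2 * p ^ e"
      using k by (simp_all add: m algebra_simps)
  qed
  moreover have "(n - 4) * k \<le> a" using a by (simp add: m algebra_simps)
  ultimately have "y 1 ^ a * u ^ a \<in> J2"
    by (simp add: J3_def mult_ac flip: power_add)
  moreover have "y 1 ^ a * y 2 ^ a = (- 1) ^ a * (y 1 ^ a * u ^ a)"
    by (simp add: u_def power_mult_distrib [symmetric])
  ultimately have "y 1 ^ a * y 2 ^ a \<in> J2" by (metis J2.mult_mem)
  moreover have "(\<Prod>i = 1..n. y i) ^ a = y 1 ^ a * y 2 ^ a * A"
    unfolding I A_def by (simp add: power_mult_distrib prod_power_distrib mult.assoc)
  ultimately show ?thesis by (simp add: J2_def)
qed

text \<open>The summand n in the exponent absorbs the remainder q - n k < n, and k \<ge> n yields q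
  \<le> (n + 1) k, which both cases require.\<close>

lemma prod_linear_power_mem:
  fixes y :: "nat \<Rightarrow> 'a" and p e k n :: nat
  assumes p: "Factorial_Ring.prime p" "(of_nat p :: 'a) = 0"
    and n: "n \<ge> 3" and k: "n \<le> k" "n * k \<le> p ^ e" "p ^ e < n * k + n"
    and sum: "(\<Sum>i = 1..n. y i) \<in> J"
    and J: "\<And>i. i \<in> {1..n} \<Longrightarrow> y i ^ ((n - 1) * k) \<in> J"
  shows "(\<Prod>i = 1..n. y i) ^ ((n - 2) * k + n) \<in> J"
proof (cases "n = 3")
  case True
  have I: "{1..n} = {1, 2, 3}" using True by auto
  have "y 1 + y 2 + y 3 \<in> J" using sum unfolding I by (simp add: add.assoc)
  then have "(y 1 * y 2 * y 3) ^ (k + 3) \<in> J"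
    using True k J by (intro prod_power_mem_three [OF p, of k e]) (auto simp: I add.assoc)
  then show ?thesis unfolding I using True by (simp add: mult.assoc)
next
  case False
  then obtain m where m: "n = m + 4" using n that [of "n - 4"] by simp
  show ?thesis
    by (rule prod_power_mem_ge_four [OF p, of n k e]) (use k sum J in \<open>auto simp: m algebra_simps\<close>)
qed

text \<open>The linear statement is applied to the powers \<open>x i ^ n\<close> with k = q div n;
  the constant \<open>n * (2 * n)\<close> in the exponent pays for rounding q down to n k.\<close>

lemma prod_diagonal_power_mem:
  fixes x :: "nat \<Rightarrow> 'a" and p e n :: nat
  assumes p: "Factorial_Ring.prime p" "(of_nat p :: 'a) = 0"
    and n: "n \<ge> 3" "n * n \<le> p ^ e"
    and sum: "(\<Sum>i = 1..n. x i ^ n) \<in> J"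
    and J: "\<And>i. i \<in> {1..n} \<Longrightarrow> x i ^ ((n - 1) * p ^ e) \<in> J"
  shows "(\<Prod>i = 1..n. x i) ^ (n * (2 * n) + (n - 2) * p ^ e) \<in> J"
proof -
  define q where "q = p ^ e"
  define k where "k = q div n"
  have k: "n \<le> k" "n * k \<le> q" "q < n * k + n"
    using n div_le_mono [of "n * n" q n] dividend_less_times_div [of n q]
    by (auto simp: k_def q_def)
  \<comment> \<open>The exponent n (n - 1) k can fall short of (n - 1) q by less than n (n - 1); the
    factor \<open>x i ^ (n * n)\<close> contained in B makes up for it.\<close>
  define B where "B = (\<Prod>i = 1..n. x i ^ n) ^ n"
  interpret C: type_ideal "{b. b * B \<in> J}" by (rule colon)
  have "(\<Prod>i = 1..n. x i ^ n) ^ ((n - 2) * k + n) \<in> {b. b * B \<in> J}"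
  proof (rule C.prod_linear_power_mem [OF p n(1), of k e])
    fix i assume i: "i \<in> {1..n}"
    have "x i ^ n dvd (\<Prod>i = 1..n. x i ^ n)" using i by (intro dvd_prodI) auto
    then have "(x i ^ n) ^ ((n - 1) * k) * (x i ^ n) ^ n dvd (x i ^ n) ^ ((n - 1) * k) * B"
      unfolding B_def by (intro mult_dvd_mono dvd_power_same) auto
    moreover have "(x i ^ n) ^ ((n - 1) * k) * (x i ^ n) ^ n = x i ^ (n * ((n - 1) * k + n))"
      by (simp add: power_add power_mult distrib_left)
    moreover have "(n - 1) * q \<le> n * ((n - 1) * k + n)"
    proof -
      have "(n - 1) * q \<le> (n - 1) * (n * k + n)" using k by simp
      also have "\<dots> \<le> n * ((n - 1) * k + n)"
        by (cases n) (auto simp: algebra_simps)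
      finally show ?thesis .
    qed
    then have "x i ^ (n * ((n - 1) * k + n)) \<in> J"
      using J [OF i] power_mem unfolding q_def by blast
    ultimately show "(x i ^ n) ^ ((n - 1) * k) \<in> {b. b * B \<in> J}"
      using dvd_mem by (metis mem_Collect_eq)
  qed (use sum k mult_mem [OF sum, of B] in \<open>auto simp: q_def mult.commute\<close>)
  then have "(\<Prod>i = 1..n. x i) ^ (n * ((n - 2) * k + n + n)) \<in> J"
    by (simp add: B_def prod_power_distrib [symmetric] power_add power_mult distrib_left)
  moreover have "n * ((n - 2) * k + n + n) \<le> n * (2 * n) + (n - 2) * q"
  proof -
    have "n * ((n - 2) * k + n + n) = n * (2 * n) + (n - 2) * (n * k)"
      by (simp add: algebra_simps)
    also have "\<dots> \<le> n * (2 * n) + (n - 2) * q" using k by simp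
    finally show ?thesis .
  qed
  ultimately show ?thesis unfolding q_def by (rule power_mem)
qed

end

section \<open>Nonzerodivisors and minimal primes\<close>

text \<open>An ideal M maximal among those disjoint from S is prime: for a and b outside M, both M +
  (a) and M + (b) meet S, and if a b were in M, the product of the two common elements would lie in
  M and in S.\<close>

lemma (in cring) ex_primeideal_disjoint:
  assumes S: "S \<subseteq> carrier R" "\<one> \<in> S" "\<zero> \<notin> S"
    and mult: "\<And>s t. s \<in> S \<Longrightarrow> t \<in> S \<Longrightarrow> s \<otimes> t \<in> S"
  shows "\<exists>Q. primeideal Q R \<and> Q \<inter> S = {}"
proof -
  define F where "F = {I. ideal I R \<and> I \<inter> S = {}}"
  have "\<exists>M\<in>F. \<forall>I\<in>F. M \<subseteq> I \<longrightarrow> I = M"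
  proof (rule subset_Zorn_nonempty)
    show "F \<noteq> {}" using zeroideal S by (auto simp: F_def)
    fix C assume C: "C \<noteq> {}" "subset.chain F C"
    have "subset.chain {I. ideal I R} C"
      using C(2) by (auto simp: F_def pred_on.chain_def)
    then show "\<Union>C \<in> F"
      using chain_Union_is_ideal [of C] C by (auto simp: F_def pred_on.chain_def)
  qed
  then obtain M where M: "ideal M R" "M \<inter> S = {}"
    and max: "\<And>I. ideal I R \<Longrightarrow> I \<inter> S = {} \<Longrightarrow> M \<subseteq> I \<Longrightarrow> I = M"
    by (auto simp: F_def)
  interpret M: ideal M R by fact
  have meets: "\<exists>m\<in>M. \<exists>r\<in>carrier R. m \<oplus> r \<otimes> a \<in> S" if a: "a \<in> carrier R" "a \<notin> M" for a
  proof -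
    have I: "ideal (M <+> PIdl a) R" using M(1) cgenideal_ideal [OF a(1)] by (rule add_ideals)
    have "M \<subseteq> M <+> PIdl a"
    proof
      fix m assume "m \<in> M"
      moreover have "\<zero> \<in> PIdl a"
        using cgenideal_ideal [OF a(1)] by (simp add: additive_subgroup.zero_closed ideal.axioms(1))
      moreover have "m = m \<oplus> \<zero>" using M.Icarr [OF \<open>m \<in> M\<close>] by simp
      ultimately show "m \<in> M <+> PIdl a" unfolding set_add_def' by blast
    qed
    moreover have "a = \<zero> \<oplus> a" using a(1) by simp
    then have "a \<in> M <+> PIdl a"
      unfolding set_add_def' using cgenideal_self [OF a(1)] M.zero_closed by blast
    ultimately have "(M <+> PIdl a) \<inter> S \<noteq> {}" using max [OF I] a(2) by blast
    then show ?thesis unfolding set_add_def' cgenideal_def by auto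
  qed
  have "primeideal M R"
  proof (rule primeidealI [OF M(1) is_cring])
    show "carrier R \<noteq> M" using M(2) S by auto
    fix a b assume a: "a \<in> carrier R" and b: "b \<in> carrier R" and ab: "a \<otimes> b \<in> M"
    show "a \<in> M \<or> b \<in> M"
    proof (rule ccontr)
      assume "\<not> (a \<in> M \<or> b \<in> M)"
      then obtain m r m' r' where *: "m \<in> M" "r \<in> carrier R" "m \<oplus> r \<otimes> a \<in> S"
        "m' \<in> M" "r' \<in> carrier R" "m' \<oplus> r' \<otimes> b \<in> S"
        using meets a b by meson
      have m: "m \<in> carrier R" "m' \<in> carrier R" using * M.Icarr by auto
      have "(m \<oplus> r \<otimes> a) \<otimes> (m' \<oplus> r' \<otimes> b)
          = m \<otimes> (m' \<oplus> r' \<otimes> b) \<oplus> (r \<otimes> a \<otimes> m' \<oplus> r \<otimes> r' \<otimes> (a \<otimes> b))"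
        using m * a b by algebra
      also have "\<dots> \<in> M"
        using m * a b ab by (simp add: M.I_l_closed M.I_r_closed)
      finally show False using mult [OF *(3,6)] M(2) by auto
    qed
  qed
  then show ?thesis using M(2) by blast
qed

text \<open>If x lay in a minimal prime P, the products of a power of x and an element outside P
  would form a multiplicative set without zero. A prime ideal disjoint from this set lies in P and
  misses x, against minimality.\<close>

lemma (in cring) nonzerodivisor_ring_circ:
  assumes x: "x \<in> carrier R" and nz: "\<And>r. r \<in> carrier R \<Longrightarrow> x \<otimes> r = \<zero> \<Longrightarrow> r = \<zero>"
  shows "x \<in> ring_circ R"
proof -
  have False if P: "minimal_prime R P" "x \<in> P" for P
  proof -
    interpret P: primeideal P R using P(1) by (simp add: minimal_prime_def)
    define S where "S = {x [^] (k::nat) \<otimes> s | k s. s \<in> carrier R - P}"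
    have one: "\<one> \<notin> P" using P.I_notcarr P.one_imp_carrier by auto
    have pow: "r = \<zero>" if "r \<in> carrier R" "x [^] k \<otimes> r = \<zero>" for r and k :: nat
      using that
    proof (induction k)
      case (Suc k)
      then have "x \<otimes> (x [^] k \<otimes> r) = \<zero>" using x by (simp add: m_ac)
      then show ?case using Suc nz [of "x [^] k \<otimes> r"] x by simp
    qed simp
    have "\<exists>Q. primeideal Q R \<and> Q \<inter> S = {}"
    proof (rule ex_primeideal_disjoint)
      show "S \<subseteq> carrier R" using x by (auto simp: S_def)
      have "\<one> = x [^] (0::nat) \<otimes> \<one>" by simp
      then show "\<one> \<in> S" unfolding S_def using one one_closed by blast
      show "\<zero> \<notin> S" using pow P.zero_closed by (force simp: S_def)
      fix s t assume "s \<in> S" "t \<in> S"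
      then obtain k l u v where u: "s = x [^] (k::nat) \<otimes> u" "u \<in> carrier R - P"
        and v: "t = x [^] (l::nat) \<otimes> v" "v \<in> carrier R - P" by (auto simp: S_def)
      have "s \<otimes> t = x [^] (k + l) \<otimes> (u \<otimes> v)"
        using x u v by (simp add: nat_pow_mult [symmetric] m_ac)
      moreover have "u \<otimes> v \<in> carrier R - P" using u v P.I_prime by auto
      ultimately show "s \<otimes> t \<in> S" unfolding S_def by blast
    qed
    then obtain Q where Q: "primeideal Q R" "Q \<inter> S = {}" by blast
    interpret Q: primeideal Q R by fact
    have "Q \<subseteq> P"
    proof
      fix r assume r: "r \<in> Q"
      show "r \<in> P"
      proof (rule ccontr)
        assume "r \<notin> P"
        moreover have "r = x [^] (0::nat) \<otimes> r" using Q.Icarr [OF r] by simp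
        ultimately have "r \<in> S" unfolding S_def using Q.Icarr [OF r] by blast
        then show False using r Q(2) by blast
      qed
    qed
    then have "Q = P" using P(1) Q(1) by (simp add: minimal_prime_def)
    moreover have "x = x [^] (1::nat) \<otimes> \<one>" using x by simp
    then have "x \<in> S" unfolding S_def using one one_closed by blast
    ultimately show False using P(2) Q(2) by blast
  qed
  then show ?thesis using x by (auto simp: ring_circ_def)
qed

lemma ring_circ_subset: "ring_circ R \<subseteq> carrier R"
  by (auto simp: ring_circ_def)

lemma (in cring) ring_circ_mult:
  assumes "a \<in> ring_circ R" "b \<in> ring_circ R"
  shows "a \<otimes> b \<in> ring_circ R"
proof -
  have "a \<otimes> b \<notin> P" if P: "minimal_prime R P" for P
  proof -
    interpret P: primeideal P R using P by (simp add: minimal_prime_def)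
    show ?thesis using P.I_prime [of a b] assms P by (auto simp: ring_circ_def)
  qed
  then show ?thesis using assms by (auto simp: ring_circ_def)
qed

lemma (in cring) ring_circ_one: "\<one> \<in> ring_circ R"
  by (rule nonzerodivisor_ring_circ) auto

lemma (in cring) ring_circ_pow:
  assumes "a \<in> ring_circ R"
  shows "a [^] (m::nat) \<in> ring_circ R"
  by (induction m) (auto simp: ring_circ_one ring_circ_mult assms)

lemma (in cring) ring_circ_finprod:
  assumes "finite A" "\<And>i. i \<in> A \<Longrightarrow> f i \<in> ring_circ R"
  shows "(\<Otimes>i\<in>A. f i) \<in> ring_circ R"
  using assms
proof (induction A rule: finite_induct)
  case (insert i A)
  then have "f \<in> A \<rightarrow> carrier R" "f i \<in> carrier R" by (auto intro: subsetD [OF ring_circ_subset])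
  then show ?case using insert by (simp add: ring_circ_mult)
qed (simp add: ring_circ_one)

section \<open>The diagonal ring\<close>

text \<open>Substitutes 0 for the variables outside S. With S = \<open>{1..n}\<close> it is a
  retraction onto the carrier of \<open>mpoly_ring n\<close>; with S = \<open>- {i}\<close> it is
  reduction modulo the variable i.\<close>

lift_definition restrict_vars :: "'v set \<Rightarrow> (('v \<Rightarrow>\<^sub>0 'e::zero) \<Rightarrow>\<^sub>0 'k::zero) \<Rightarrow> (('v \<Rightarrow>\<^sub>0 'e) \<Rightarrow>\<^sub>0 'k)"
  is "\<lambda>S f m. if Poly_Mapping.keys m \<subseteq> S then f m else 0"
  by (rule finite_subset) auto

lemma keys_restrict_vars: "Poly_Mapping.keys (restrict_vars S f) = {m \<in> Poly_Mapping.keys f. Poly_Mapping.keys m \<subseteq> S}"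
  by (auto simp: in_keys_iff [of _ f] in_keys_iff [of _ "restrict_vars S f"] restrict_vars.rep_eq split: if_splits)

lemma restrict_vars_add: "restrict_vars S (f + g) = restrict_vars S f + restrict_vars S (g :: ('v \<Rightarrow>\<^sub>0 'e::zero) \<Rightarrow>\<^sub>0 'k::monoid_add)"
  by (rule poly_mapping_eqI) (simp add: restrict_vars.rep_eq lookup_add)

lemma restrict_vars_eq_0_iff:
  "restrict_vars S f = 0 \<longleftrightarrow> (\<forall>m \<in> Poly_Mapping.keys f. \<not> Poly_Mapping.keys m \<subseteq> S)"
  by (auto simp: keys_restrict_vars simp flip: keys_eq_empty)

lemma restrict_vars_id:
  assumes "\<And>m. m \<in> Poly_Mapping.keys f \<Longrightarrow> Poly_Mapping.keys m \<subseteq> S"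
  shows "restrict_vars S f = f"
  using assms by (intro poly_mapping_eqI) (auto simp: restrict_vars.rep_eq in_keys_iff)

lemma keys_add_nat: "Poly_Mapping.keys (a + b :: 'v \<Rightarrow>\<^sub>0 nat) = Poly_Mapping.keys a \<union> Poly_Mapping.keys b"
  by (auto simp: in_keys_iff lookup_add)

text \<open>Monomials involving a variable outside S span an ideal, because natural exponents cannot
  cancel. Hence f and g may be replaced by their restrictions, whose product is left unchanged by
  restriction.\<close>

lemma restrict_vars_mult:
  fixes f g :: "('v \<Rightarrow>\<^sub>0 nat) \<Rightarrow>\<^sub>0 'k::comm_ring_1"
  shows "restrict_vars S (f * g) = restrict_vars S f * restrict_vars S g"
proof -
  have vanish: "restrict_vars S (u * v) = 0" if "restrict_vars S u = 0" for u v :: "('v \<Rightarrow>\<^sub>0 nat) \<Rightarrow>\<^sub>0 'k"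
    unfolding restrict_vars_eq_0_iff
  proof
    fix m assume "m \<in> Poly_Mapping.keys (u * v)"
    then obtain a b where "m = a + b" "a \<in> Poly_Mapping.keys u"
      using keys_mult [of u v] by blast
    then show "\<not> Poly_Mapping.keys m \<subseteq> S"
      using that by (auto simp: restrict_vars_eq_0_iff keys_add_nat)
  qed
  have diff: "restrict_vars S (u - restrict_vars S u) = 0" for u :: "('v \<Rightarrow>\<^sub>0 nat) \<Rightarrow>\<^sub>0 'k"
    by (rule poly_mapping_eqI) (simp add: restrict_vars.rep_eq lookup_minus)
  have prod: "restrict_vars S (restrict_vars S f * restrict_vars S g) = restrict_vars S f * restrict_vars S g"
  proof (rule restrict_vars_id)
    fix m assume "m \<in> Poly_Mapping.keys (restrict_vars S f * restrict_vars S g)"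
    then obtain a b where "m = a + b" "a \<in> Poly_Mapping.keys (restrict_vars S f)"
        "b \<in> Poly_Mapping.keys (restrict_vars S g)"
      using keys_mult by blast
    then show "Poly_Mapping.keys m \<subseteq> S" by (auto simp: keys_restrict_vars keys_add_nat)
  qed
  have "f * g = (f - restrict_vars S f) * g + ((g - restrict_vars S g) * restrict_vars S f + restrict_vars S f * restrict_vars S g)"
    by (simp add: algebra_simps)
  also have "restrict_vars S \<dots> = restrict_vars S f * restrict_vars S g"
    by (simp add: restrict_vars_add vanish [OF diff] prod)
  finally show ?thesis .
qed

lemma restrict_vars_1: "restrict_vars S (1 :: ('v \<Rightarrow>\<^sub>0 nat) \<Rightarrow>\<^sub>0 'k::zero_neq_one) = 1"
  by (rule restrict_vars_id) (simp add: in_keys_iff lookup_one)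

lemma mpoly_var_power: "mpoly_var i ^ m = Poly_Mapping.single (Poly_Mapping.single i m) 1"
  by (induction m) (simp_all add: mpoly_var_def mult_single single_add [symmetric])

lemma keys_mpoly_var: "Poly_Mapping.keys (mpoly_var i :: (nat \<Rightarrow>\<^sub>0 nat) \<Rightarrow>\<^sub>0 'k::field) = {Poly_Mapping.single i 1}"
  by (simp add: mpoly_var_def)

lemma poly_mapping_eq_sum_single:
  "f = (\<Sum>m\<in>Poly_Mapping.keys f. Poly_Mapping.single m (Poly_Mapping.lookup f m))"
  by (rule poly_mapping_eqI) (auto simp: lookup_sum lookup_single when_def in_keys_iff)

text \<open>Every monomial of h contains the variable i, so one factor can be removed from each. The
  second conclusion serves to keep the quotient in the carrier of
  \<open>mpoly_ring n\<close>.\<close>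

lemma mpoly_var_dvd:
  fixes h :: "(nat \<Rightarrow>\<^sub>0 nat) \<Rightarrow>\<^sub>0 'k::field"
  assumes "restrict_vars (- {i}) h = 0"
  obtains g where "h = mpoly_var i * g"
    "\<And>m. m \<in> Poly_Mapping.keys g \<Longrightarrow> m + Poly_Mapping.single i 1 \<in> Poly_Mapping.keys h"
proof
  define e :: "nat \<Rightarrow>\<^sub>0 nat" where "e = Poly_Mapping.single i 1"
  define g where "g = (\<Sum>m\<in>Poly_Mapping.keys h. Poly_Mapping.single (m - e) (Poly_Mapping.lookup h m))"
  \<comment> \<open>The truncated subtraction is exact, since i occurs in m.\<close>
  have e: "m - e + e = m" if "m \<in> Poly_Mapping.keys h" for m
  proof (rule poly_mapping_eqI)
    fix j
    have "i \<in> Poly_Mapping.keys m" using assms that by (auto simp: restrict_vars_eq_0_iff)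
    then show "Poly_Mapping.lookup (m - e + e) j = Poly_Mapping.lookup m j"
      by (auto simp: e_def lookup_add lookup_minus lookup_single when_def in_keys_iff)
  qed
  have "mpoly_var i * Poly_Mapping.single (m - e) c = Poly_Mapping.single m c"
    if "m \<in> Poly_Mapping.keys h" for m and c :: 'k
    unfolding mpoly_var_def mult_single e_def [symmetric] using e [OF that] by (simp add: add.commute)
  then have "mpoly_var i * g = (\<Sum>m\<in>Poly_Mapping.keys h. Poly_Mapping.single m (Poly_Mapping.lookup h m))"
    unfolding g_def sum_distrib_left by (intro sum.cong) auto
  then show "h = mpoly_var i * g"
    by (rule trans [OF poly_mapping_eq_sum_single sym])
  fix m assume "m \<in> Poly_Mapping.keys g"
  then have "m \<in> (\<Union>m'\<in>Poly_Mapping.keys h.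
      Poly_Mapping.keys (Poly_Mapping.single (m' - e) (Poly_Mapping.lookup h m')))"
    unfolding g_def by (rule subsetD [OF keys_sum])
  then obtain m' where "m' \<in> Poly_Mapping.keys h" "m = m' - e" by (auto split: if_splits)
  then show "m + Poly_Mapping.single i 1 \<in> Poly_Mapping.keys h"
    using e by (simp add: e_def)
qed

section \<open>The polynomial ring and the diagonal form\<close>

lemma mpoly_ring_simps:
  "monoid.mult (mpoly_ring n) = (*)" "ring.add (mpoly_ring n) = (+)"
  "monoid.one (mpoly_ring n) = 1" "ring.zero (mpoly_ring n) = 0"
  "carrier (mpoly_ring n) = {f. \<forall>m \<in> Poly_Mapping.keys f. Poly_Mapping.keys m \<subseteq> {1..n}}"
  by (auto simp: mpoly_ring_def ring_of_type_algebra_def)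

lemma mpoly_var_carrier: "i \<in> {1..n} \<Longrightarrow> mpoly_var i \<in> carrier (mpoly_ring n)"
  by (auto simp: mpoly_ring_simps keys_mpoly_var)

lemma restrict_vars_carrier: "restrict_vars {1..n} f \<in> carrier (mpoly_ring n)"
  by (auto simp: mpoly_ring_simps keys_restrict_vars)

lemma restrict_vars_carrier_id: "f \<in> carrier (mpoly_ring n) \<Longrightarrow> restrict_vars {1..n} f = f"
  by (rule restrict_vars_id) (auto simp: mpoly_ring_simps)

lemma mpoly_ring_sum:
  assumes "finite A" "\<And>i. i \<in> A \<Longrightarrow> f i \<in> carrier (mpoly_ring n)"
  shows "sum f A \<in> carrier (mpoly_ring n)"
proof -
  interpret P: cring "mpoly_ring n" by (rule cring_mpoly_ring)
  show ?thesis using assms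
    by (induction A rule: finite_induct)
      (use P.zero_closed P.a_closed in \<open>auto simp del: P.zero_closed P.a_closed simp: mpoly_ring_simps(2,4)\<close>)
qed

lemma mpoly_ring_pow: "f [^]\<^bsub>mpoly_ring n\<^esub> (m::nat) = f ^ m"
  by (induction m) (simp_all add: nat_pow_def mpoly_ring_simps mult.commute)

definition diagonal_poly :: "nat \<Rightarrow> (nat \<Rightarrow>\<^sub>0 nat) \<Rightarrow>\<^sub>0 'k::field"
  where "diagonal_poly n = (\<Sum>i = 1..n. mpoly_var i ^ n)"

lemma diagonal_poly_carrier: "diagonal_poly n \<in> carrier (mpoly_ring n)"
proof -
  interpret P: cring "mpoly_ring n" by (rule cring_mpoly_ring)
  show ?thesis unfolding diagonal_poly_def
    using P.nat_pow_closed [OF mpoly_var_carrier]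
    by (intro mpoly_ring_sum) (simp_all add: mpoly_ring_pow)
qed

lemma diagonal_ideal_ideal: "ideal (diagonal_ideal n) (mpoly_ring n)"
proof -
  interpret P: cring "mpoly_ring n" by (rule cring_mpoly_ring)
  show ?thesis unfolding diagonal_ideal_def
    using diagonal_poly_carrier by (intro P.genideal_ideal) (simp add: diagonal_poly_def)
qed

lemma diagonal_poly_mem: "diagonal_poly n \<in> diagonal_ideal n"
proof -
  interpret P: cring "mpoly_ring n" by (rule cring_mpoly_ring)
  show ?thesis
    unfolding diagonal_ideal_def diagonal_poly_def [symmetric]
    by (rule P.genideal_self' [OF diagonal_poly_carrier])
qed

lemma diagonal_ideal_eq: "diagonal_ideal n = {h * diagonal_poly n | h. h \<in> carrier (mpoly_ring n)}"
proof -
  interpret P: cring "mpoly_ring n" by (rule cring_mpoly_ring)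
  show ?thesis
    unfolding diagonal_ideal_def diagonal_poly_def [symmetric]
      P.cgenideal_eq_genideal [OF diagonal_poly_carrier, symmetric] cgenideal_def mpoly_ring_simps(1) ..
qed

text \<open>One of the variables 1 and 2 differs from the variable i; its n-th power has coefficient
  1 in the form and survives.\<close>

lemma restrict_vars_diagonal_poly_nonzero:
  assumes "n \<ge> 2"
  shows "restrict_vars (- {i}) (diagonal_poly n :: (nat \<Rightarrow>\<^sub>0 nat) \<Rightarrow>\<^sub>0 'k::field) \<noteq> 0"
proof -
  define j :: nat where "j = (if i = 1 then 2 else 1)"
  have j: "j \<in> {1..n}" "j \<noteq> i" using assms by (auto simp: j_def)
  let ?m = "Poly_Mapping.single j n :: nat \<Rightarrow>\<^sub>0 nat"
  have eq: "Poly_Mapping.single k n = ?m \<longleftrightarrow> k = j" for k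
    using assms by (metis lookup_single_eq lookup_single_not_eq not_numeral_le_zero)
  have "Poly_Mapping.lookup (diagonal_poly n :: (nat \<Rightarrow>\<^sub>0 nat) \<Rightarrow>\<^sub>0 'k) ?m
      = (\<Sum>k = 1..n. if k = j then 1 else 0)"
    unfolding diagonal_poly_def lookup_sum mpoly_var_power
    by (intro sum.cong) (simp_all add: lookup_single eq)
  also have "\<dots> = 1" using j by simp
  finally have "?m \<in> Poly_Mapping.keys (diagonal_poly n :: (nat \<Rightarrow>\<^sub>0 nat) \<Rightarrow>\<^sub>0 'k)"
    by (simp add: in_keys_iff)
  then show ?thesis using j assms by (force simp: restrict_vars_eq_0_iff)
qed

text \<open>Setting the variable i to zero in \<open>mpoly_var i * g = h * diagonal_poly n\<close>
  kills the left side but not the form. As polynomials form a domain, the variable divides h and can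
  be cancelled.\<close>

lemma mpoly_var_mult_mem_diagonal_ideal:
  fixes g :: "(nat \<Rightarrow>\<^sub>0 nat) \<Rightarrow>\<^sub>0 'k::field"
  assumes n: "n \<ge> 2" and g: "mpoly_var i * g \<in> diagonal_ideal n"
  shows "g \<in> diagonal_ideal n"
proof -
  obtain h where h: "mpoly_var i * g = h * diagonal_poly n" "h \<in> carrier (mpoly_ring n)"
    using g by (auto simp: diagonal_ideal_eq)
  have "restrict_vars (- {i}) (mpoly_var i :: (nat \<Rightarrow>\<^sub>0 nat) \<Rightarrow>\<^sub>0 'k) = 0"
    by (auto simp: restrict_vars_eq_0_iff keys_mpoly_var)
  then have "restrict_vars (- {i}) h * restrict_vars (- {i}) (diagonal_poly n) = 0"
    using h(1) by (metis restrict_vars_mult mult_zero_left)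
  then have "restrict_vars (- {i}) h = 0"
    using restrict_vars_diagonal_poly_nonzero [OF n, of i] by auto
  then obtain k where k: "h = mpoly_var i * k"
    "\<And>m. m \<in> Poly_Mapping.keys k \<Longrightarrow> m + Poly_Mapping.single i 1 \<in> Poly_Mapping.keys h"
    using mpoly_var_dvd by blast
  have "k \<in> carrier (mpoly_ring n)"
    using k(2) h(2) by (fastforce simp: mpoly_ring_simps keys_add_nat)
  moreover have "(mpoly_var i :: (nat \<Rightarrow>\<^sub>0 nat) \<Rightarrow>\<^sub>0 'k) \<noteq> 0"
    using keys_mpoly_var [of i, where 'k = 'k] by auto
  then have "g = k * diagonal_poly n" using h(1) k(1) by (simp add: mult.assoc)
  ultimately show ?thesis by (auto simp: diagonal_ideal_eq)
qed

section \<open>The quotient ring and the map onto it\<close>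

lemma cring_diagonal_ring: "cring (diagonal_ring n)"
  unfolding diagonal_ring_def
  by (rule ideal.quotient_is_cring [OF diagonal_ideal_ideal cring_mpoly_ring])

text \<open>
  Precomposing with \<^const>\<open>restrict_vars\<close> makes the quotient map total on the polynomial type, so that
  computations can take place in the type class \<^class>\<open>comm_ring_1\<close>.
\<close>

definition diagonal_map :: "nat \<Rightarrow> ((nat \<Rightarrow>\<^sub>0 nat) \<Rightarrow>\<^sub>0 'k::field) \<Rightarrow> ((nat \<Rightarrow>\<^sub>0 nat) \<Rightarrow>\<^sub>0 'k) set"
  where "diagonal_map n f = diagonal_ideal n +>\<^bsub>mpoly_ring n\<^esub> restrict_vars {1..n} f"

lemma diagonal_map_closed: "diagonal_map n f \<in> carrier (diagonal_ring n)"
  unfolding diagonal_map_def diagonal_ring_def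
  by (rule ring_hom_closed [OF ideal.rcos_ring_hom [OF diagonal_ideal_ideal] restrict_vars_carrier])

lemma diagonal_map_add:
  "diagonal_map n (f + g) = diagonal_map n f \<oplus>\<^bsub>diagonal_ring n\<^esub> diagonal_map n g"
  using ring_hom_add [OF ideal.rcos_ring_hom [OF diagonal_ideal_ideal] restrict_vars_carrier restrict_vars_carrier, of n f g]
  by (simp add: diagonal_map_def diagonal_ring_def restrict_vars_add mpoly_ring_simps)

lemma diagonal_map_mult:
  "diagonal_map n (f * g) = diagonal_map n f \<otimes>\<^bsub>diagonal_ring n\<^esub> diagonal_map n g"
  using ring_hom_mult [OF ideal.rcos_ring_hom [OF diagonal_ideal_ideal] restrict_vars_carrier restrict_vars_carrier, of n f g]
  by (simp add: diagonal_map_def diagonal_ring_def restrict_vars_mult mpoly_ring_simps)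

lemma diagonal_map_1: "diagonal_map n 1 = \<one>\<^bsub>diagonal_ring n\<^esub>"
  using ring_hom_one [OF ideal.rcos_ring_hom [OF diagonal_ideal_ideal], of n]
  by (simp add: diagonal_map_def diagonal_ring_def restrict_vars_1 mpoly_ring_simps)

lemma diagonal_map_eq_zero_iff:
  assumes "f \<in> carrier (mpoly_ring n)"
  shows "diagonal_map n f = \<zero>\<^bsub>diagonal_ring n\<^esub> \<longleftrightarrow> f \<in> diagonal_ideal n"
proof -
  interpret P: cring "mpoly_ring n" by (rule cring_mpoly_ring)
  interpret I: ideal "diagonal_ideal n" "mpoly_ring n" by (rule diagonal_ideal_ideal)
  have z: "\<zero>\<^bsub>diagonal_ring n\<^esub> = diagonal_ideal n"
    by (simp add: diagonal_ring_def FactRing_def)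
  show ?thesis
    unfolding diagonal_map_def restrict_vars_carrier_id [OF assms] z
    using I.a_rcos_self [OF assms] I.a_rcos_const by auto
qed

lemma diagonal_map_0: "diagonal_map n (0 :: (nat \<Rightarrow>\<^sub>0 nat) \<Rightarrow>\<^sub>0 'k::field) = \<zero>\<^bsub>diagonal_ring n\<^esub>"
proof -
  interpret R: cring "diagonal_ring n :: ((nat \<Rightarrow>\<^sub>0 nat) \<Rightarrow>\<^sub>0 'k) set ring" by (rule cring_diagonal_ring)
  show ?thesis
    using diagonal_map_add [of n 0 "0 :: (nat \<Rightarrow>\<^sub>0 nat) \<Rightarrow>\<^sub>0 'k"]
      R.add.r_cancel_one' [OF diagonal_map_closed diagonal_map_closed]
    by simp
qed

lemma diagonal_map_power: "diagonal_map n (f ^ m) = diagonal_map n f [^]\<^bsub>diagonal_ring n\<^esub> (m::nat)"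
proof -
  interpret R: cring "diagonal_ring n" by (rule cring_diagonal_ring)
  show ?thesis
    by (induction m) (simp_all add: diagonal_map_1 diagonal_map_mult diagonal_map_closed R.m_comm)
qed

lemma diagonal_map_prod:
  assumes "finite A"
  shows "diagonal_map n (\<Prod>i\<in>A. f i) = (\<Otimes>\<^bsub>diagonal_ring n\<^esub>i\<in>A. diagonal_map n (f i))"
proof -
  interpret R: cring "diagonal_ring n" by (rule cring_diagonal_ring)
  show ?thesis using assms
    by (induction A rule: finite_induct) (simp_all add: diagonal_map_1 diagonal_map_mult diagonal_map_closed)
qed

lemma diagonal_map_of_nat:
  "diagonal_map n (of_nat m) = add_pow (diagonal_ring n) m \<one>\<^bsub>diagonal_ring n\<^esub>"
proof -
  interpret R: cring "diagonal_ring n" by (rule cring_diagonal_ring)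
  show ?thesis
    by (induction m)
      (simp_all add: diagonal_map_0 diagonal_map_1 diagonal_map_add diagonal_map_closed R.a_comm)
qed

lemma diagonal_map_var:
  assumes "i \<in> {1..n}"
  shows "diagonal_map n (mpoly_var i) = diagonal_var n i"
  unfolding diagonal_map_def diagonal_var_def
  by (simp only: restrict_vars_carrier_id [OF mpoly_var_carrier [OF assms]])

text \<open>Membership in an ideal of the quotient thus becomes a question about polynomials, open
  to the results on \<open>type_ideal\<close>.\<close>

lemma type_ideal_diagonal_map_vimage:
  assumes "ideal K (diagonal_ring n)"
  shows "type_ideal {f. diagonal_map n f \<in> K}"
proof -
  interpret K: ideal K "diagonal_ring n" by fact
  show ?thesis
    by unfold_locales
      (auto simp: diagonal_map_0 diagonal_map_add diagonal_map_mult diagonal_map_closed K.I_l_closed)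
qed

lemma diagonal_var_ring_circ:
  fixes n i :: nat
  assumes n: "n \<ge> 2" and i: "i \<in> {1..n}"
  shows "(diagonal_var n i :: ((nat \<Rightarrow>\<^sub>0 nat) \<Rightarrow>\<^sub>0 'k::field) set) \<in> ring_circ (diagonal_ring n)"
proof -
  interpret P: cring "mpoly_ring n :: ((nat \<Rightarrow>\<^sub>0 nat) \<Rightarrow>\<^sub>0 'k) ring" by (rule cring_mpoly_ring)
  interpret R: cring "diagonal_ring n :: ((nat \<Rightarrow>\<^sub>0 nat) \<Rightarrow>\<^sub>0 'k) set ring" by (rule cring_diagonal_ring)
  show ?thesis
  proof (rule R.nonzerodivisor_ring_circ)
    show "(diagonal_var n i :: ((nat \<Rightarrow>\<^sub>0 nat) \<Rightarrow>\<^sub>0 'k) set) \<in> carrier (diagonal_ring n)"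
      using diagonal_map_closed diagonal_map_var [OF i] by metis
    fix r :: "((nat \<Rightarrow>\<^sub>0 nat) \<Rightarrow>\<^sub>0 'k) set"
    assume r: "r \<in> carrier (diagonal_ring n)"
      "diagonal_var n i \<otimes>\<^bsub>diagonal_ring n\<^esub> r = \<zero>\<^bsub>diagonal_ring n\<^esub>"
    obtain g where g: "g \<in> carrier (mpoly_ring n)" "r = diagonal_ideal n +>\<^bsub>mpoly_ring n\<^esub> g"
      using r(1) by (auto simp: diagonal_ring_def FactRing_def A_RCOSETS_defs a_r_coset_def)
    then have rg: "r = diagonal_map n g"
      by (simp add: diagonal_map_def restrict_vars_carrier_id del: One_nat_def)
    have "mpoly_var i * g \<in> carrier (mpoly_ring n)"
      using P.m_closed [OF mpoly_var_carrier [OF i] g(1)] by (simp add: mpoly_ring_simps(1))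
    moreover have "diagonal_map n (mpoly_var i * g) = \<zero>\<^bsub>diagonal_ring n\<^esub>"
      using r(2) by (simp only: rg diagonal_map_mult diagonal_map_var [OF i])
    ultimately have "mpoly_var i * g \<in> diagonal_ideal n" by (simp only: diagonal_map_eq_zero_iff)
    then show "r = \<zero>\<^bsub>diagonal_ring n\<^esub>"
      using mpoly_var_mult_mem_diagonal_ideal [OF n] diagonal_map_eq_zero_iff [OF g(1)] rg by blast
  qed
qed

section \<open>Tight closure of the ideal of powers of the variables\<close>

theorem theorem4p1:
  fixes n p :: nat
    and R :: "((nat \<Rightarrow>\<^sub>0 nat) \<Rightarrow>\<^sub>0 'k::field) set ring"
    and x :: "nat \<Rightarrow> ((nat \<Rightarrow>\<^sub>0 nat) \<Rightarrow>\<^sub>0 'k) set"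
  assumes "n \<ge> 3"
    and "Factorial_Ring.prime p"
    and "CHAR('k) = p"
    and "\<not> p dvd n"
  defines "R \<equiv> diagonal_ring n"
    and "x \<equiv> diagonal_var n"
  shows "(\<Otimes>\<^bsub>R\<^esub>i\<in>{1..n}. x i) [^]\<^bsub>R\<^esub> (n - 2)
    \<in> tight_closure p R (Idl\<^bsub>R\<^esub> ((\<lambda>i. x i [^]\<^bsub>R\<^esub> (n - 1)) ` {1..n}))"
proof -
  interpret R: cring R unfolding R_def by (rule cring_diagonal_ring)
  let ?X = "mpoly_var :: nat \<Rightarrow> (nat \<Rightarrow>\<^sub>0 nat) \<Rightarrow>\<^sub>0 'k"
  let ?A = "(\<lambda>i. x i [^]\<^bsub>R\<^esub> (n - 1)) ` {1..n}"
  have var: "diagonal_map n (?X i) = x i" if "i \<in> {1..n}" for i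
    unfolding x_def using that by (rule diagonal_map_var)
  have x: "x i \<in> ring_circ R" if "i \<in> {1..n}" for i
    unfolding x_def R_def using that assms(1) by (intro diagonal_var_ring_circ) auto
  then have xc: "x i \<in> carrier R" if "i \<in> {1..n}" for i
    using that by (auto intro: subsetD [OF ring_circ_subset])
  have A: "finite ?A" "?A \<subseteq> carrier R" using xc by auto
  have char0: "(of_nat p :: (nat \<Rightarrow>\<^sub>0 nat) \<Rightarrow>\<^sub>0 'k) = 0"
    using assms(3) by (metis of_nat_CHAR single_of_nat single_zero)
  have charR: "add_pow R p \<one>\<^bsub>R\<^esub> = \<zero>\<^bsub>R\<^esub>"
    using diagonal_map_of_nat [of n p, where 'a = 'k] unfolding R_def char0 diagonal_map_0 by simp
  define u where "u = (\<Otimes>\<^bsub>R\<^esub>i\<in>{1..n}. x i)"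
  have u: "u \<in> ring_circ R" unfolding u_def using x by (intro R.ring_circ_finprod) auto
  then have uc: "u \<in> carrier R" by (rule subsetD [OF ring_circ_subset])
  have uX: "u = diagonal_map n (\<Prod>i = 1..n. ?X i)"
    unfolding u_def R_def diagonal_map_prod [OF finite_atLeastAtMost]
    using xc var by (intro R.finprod_cong' [unfolded R_def]) (auto simp: R_def)
  \<comment> \<open>The multiplier is a power of u that does not depend on e, and it lies in
    \<open>ring_circ R\<close> together with u.\<close>
  have "u [^]\<^bsub>R\<^esub> (n * (2 * n)) \<otimes>\<^bsub>R\<^esub> (u [^]\<^bsub>R\<^esub> (n - 2)) [^]\<^bsub>R\<^esub> (p ^ e)
      \<in> frobenius_power R (Idl\<^bsub>R\<^esub> ?A) (p ^ e)" if e: "n * n \<le> e" for e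
  proof -
    let ?B = "(\<lambda>a. a [^]\<^bsub>R\<^esub> (p ^ e)) ` ?A"
    have B: "?B \<subseteq> carrier R" using A by auto
    have K: "ideal (Idl\<^bsub>R\<^esub> ?B) R" using B by (rule R.genideal_ideal)
    interpret J: type_ideal "{f. diagonal_map n f \<in> Idl\<^bsub>R\<^esub> ?B}"
      using K unfolding R_def by (rule type_ideal_diagonal_map_vimage)
    \<comment> \<open>Bounding q below by e gives the threshold n * n for e, whatever p is.\<close>
    have "e < p ^ e" using prime_gt_1_nat [OF assms(2)] by (simp add: power_gt_expt)
    then have "n * n \<le> p ^ e" using e by simp
    then have "(\<Prod>i = 1..n. ?X i) ^ (n * (2 * n) + (n - 2) * p ^ e) \<in> {f. diagonal_map n f \<in> Idl\<^bsub>R\<^esub> ?B}"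
    proof (rule J.prod_diagonal_power_mem [OF assms(2) char0 assms(1)])
      have "diagonal_map n (\<Sum>i = 1..n. ?X i ^ n) = \<zero>\<^bsub>R\<^esub>"
        unfolding R_def diagonal_poly_def [symmetric] diagonal_map_eq_zero_iff [OF diagonal_poly_carrier]
        by (rule diagonal_poly_mem)
      then show "(\<Sum>i = 1..n. ?X i ^ n) \<in> {f. diagonal_map n f \<in> Idl\<^bsub>R\<^esub> ?B}"
        using K by (simp add: additive_subgroup.zero_closed ideal.axioms(1))
      fix i assume i: "i \<in> {1..n}"
      have "diagonal_map n (?X i ^ ((n - 1) * p ^ e)) = (x i [^]\<^bsub>R\<^esub> (n - 1)) [^]\<^bsub>R\<^esub> (p ^ e)"
        using xc [OF i] by (simp only: diagonal_map_power var [OF i] R_def [symmetric] R.nat_pow_pow)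
      also have "\<dots> \<in> Idl\<^bsub>R\<^esub> ?B" using R.genideal_self [OF B] i by blast
      finally show "?X i ^ ((n - 1) * p ^ e) \<in> {f. diagonal_map n f \<in> Idl\<^bsub>R\<^esub> ?B}" by simp
    qed
    then have "u [^]\<^bsub>R\<^esub> (n * (2 * n) + (n - 2) * p ^ e) \<in> Idl\<^bsub>R\<^esub> ?B"
      by (simp only: mem_Collect_eq diagonal_map_power uX R_def)
    then show ?thesis
      unfolding R.frobenius_power_genideal [OF assms(2) charR A]
      using uc by (simp add: R.nat_pow_mult R.nat_pow_pow)
  qed
  then have "\<forall>\<^sub>F e in sequentially. u [^]\<^bsub>R\<^esub> (n * (2 * n)) \<otimes>\<^bsub>R\<^esub> (u [^]\<^bsub>R\<^esub> (n - 2)) [^]\<^bsub>R\<^esub> (p ^ e)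
      \<in> frobenius_power R (Idl\<^bsub>R\<^esub> ?A) (p ^ e)"
    by (rule eventually_sequentiallyI)
  then show ?thesis
    unfolding tight_closure_def u_def [symmetric] using R.ring_circ_pow [OF u] uc by blast
qed

end
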